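(* For any nonempty graph $H$ of order $n'$ and any positive integers $r,t$ with $r\le t$ and $t\ge 2$, $$\gamma_{\rm sp}(K_{r,t}\circ H)=t\,\gamma_{\rm sp}(H)+rn'.$$
   Context: All graphs are finite, simple and undirected; the order of a graph is its number of vertices. A nonempty graph is one with at least one edge. $K_{r,t}$ is the complete bipartite graph with parts of sizes $r$ and $t$. For a vertex $v$ of $G$, $N(v)$ is the set of vertices adjacent to $v$, and for $D\subseteq V(G)$, $\overline{D}=V(G)\setminus D$. A set $D\subseteq V(G)$ is a super dominating set of $G$ if for every $u\in\overline{D}$ there exists $v\in D$ such that $N(v)\cap\overline{D}=\{u\}$. The super domination number $\gamma_{\rm sp}(G)$ is the minimum cardinality of a super dominating set of $G$. The lexicographic product $G\circ H$ has vertex set $V(G)\times V(H)$, and $(g,h)$ is adjacent to $(g',h')$ if and only if $gg'\in E(G)$, or $g=g'$ and $hh'\in E(H)$. *)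

theory Defs
  imports "Graph_Theory.Graph_Theory"
begin

text \<open>
  Finite simple undirected graphs are \<^locale>\<open>pair_graph\<close>s: symmetric, loop-free finite
  digraphs whose arcs are pairs of vertices. An undirected edge is represented by its two
  opposite arcs.
\<close>

definition nbhd :: "'a pair_pre_digraph \<Rightarrow> 'a \<Rightarrow> 'a set" where
  "nbhd G v = {u. v \<rightarrow>\<^bsub>with_proj G\<^esub> u}"

definition super_dominating :: "'a pair_pre_digraph \<Rightarrow> 'a set \<Rightarrow> bool" where
  "super_dominating G D \<longleftrightarrow> D \<subseteq> pverts G \<and>
     (\<forall>u \<in> pverts G - D. \<exists>v \<in> D. nbhd G v \<inter> (pverts G - D) = {u})"

text \<open>
  The minimum is over a nonempty finite set for every finite graph, since the whole vertex set
  is super dominating.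
\<close>

definition super_domination_number :: "'a pair_pre_digraph \<Rightarrow> nat" (\<open>\<gamma>\<^sub>s\<^sub>p\<close>) where
  "\<gamma>\<^sub>s\<^sub>p G = Min (card ` {D. super_dominating G D})"

definition lex_product ::
  "'a pair_pre_digraph \<Rightarrow> 'b pair_pre_digraph \<Rightarrow> ('a \<times> 'b) pair_pre_digraph"
  (infixl \<open>\<circ>\<^sub>L\<close> 70) where
  "G \<circ>\<^sub>L H = \<lparr> pverts = pverts G \<times> pverts H,
     parcs = {((g, h), (g', h')) | g h g' h'.
       g \<in> pverts G \<and> h \<in> pverts H \<and> g' \<in> pverts G \<and> h' \<in> pverts H \<and>
       (g \<rightarrow>\<^bsub>with_proj G\<^esub> g' \<or> g = g' \<and> h \<rightarrow>\<^bsub>with_proj H\<^esub> h')} \<rparr>"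

lemma pair_graph_lex_product:
  assumes "pair_graph G" "pair_graph H"
  shows "pair_graph (G \<circ>\<^sub>L H)"
proof -
  interpret G: pair_graph G by fact
  interpret H: pair_graph H by fact
  have sG: "(b, a) \<in> parcs G" if "(a, b) \<in> parcs G" for a b
    using G.sym_arcs that by (auto simp: symmetric_def sym_def arcs_ends_def arc_to_ends_def)
  have sH: "(b, a) \<in> parcs H" if "(a, b) \<in> parcs H" for a b
    using H.sym_arcs that by (auto simp: symmetric_def sym_def arcs_ends_def arc_to_ends_def)
  have fin: "finite (parcs (G \<circ>\<^sub>L H))"
    by (rule finite_subset[of _ "(pverts G \<times> pverts H) \<times> (pverts G \<times> pverts H)"])
       (auto simp: lex_product_def)
  show ?thesis
    by unfold_locales
       (use fin sG sH G.no_loops H.no_loops in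
         \<open>auto simp: lex_product_def symmetric_def sym_def arcs_ends_def arc_to_ends_def\<close>)
qed

end

theory Submission
  imports Defs
begin

text \<open>
  Write \<open>C\<close> for the complement of a super dominating set of \<open>K \<circ> H\<close>; the claim is that the
  largest possible \<open>C\<close> has \<open>t * (n' - \<gamma> H)\<close> elements.

  Large complements exist because an independent set of \<open>K\<close> carries disjoint copies of \<open>H\<close> with
  no arcs between them. In each copy over the larger part, the complement of a minimum super
  dominating set of \<open>H\<close> may be left out (\<open>super_dominating_lex_independent\<close>).

  Conversely, a vertex dominating from another copy of \<open>H\<close> sees the whole copy of the vertex it
  dominates, so this happens only if \<open>C\<close> has a single vertex in that copy. If \<open>C\<close> has more, its
  trace on the copy is itself the complement of a super dominating set of \<open>H\<close>. As \<open>H\<close> has an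
  edge, \<open>\<gamma> H < n'\<close>, and so \<open>C\<close> has at most \<open>n' - \<gamma> H\<close> vertices in every copy
  (\<open>card_fibre_complement_le\<close>). This suffices if \<open>C\<close> lives over one part only, since both parts
  have at most \<open>t\<close> vertices. If \<open>C\<close> meets the copies over both parts, then a vertex of \<open>C\<close>
  cannot be dominated from its own part, since the dominating vertex would also see \<open>C\<close> over the
  opposite part; and a dominating vertex from the opposite part sees the entire part of the vertex
  it dominates (\<open>complement_meets_both_parts\<close>). So \<open>C\<close> has just two vertices, and
  \<open>2 \<le> t \<le> t * (n' - \<gamma> H)\<close>.
\<close>

section \<open>Super domination numbers\<close>

lemma in_nbhd_iff [simp]: "u \<in> nbhd G v \<longleftrightarrow> (v, u) \<in> parcs G"
  by (simp add: nbhd_def)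

lemma super_dominatingE:
  assumes "super_dominating G D" and "u \<in> pverts G - D"
  obtains v where "v \<in> D" and "v \<in> pverts G"
    and "\<forall>x \<in> pverts G - D. (v, x) \<in> parcs G \<longleftrightarrow> x = u"
proof -
  obtain v where v: "v \<in> D" and N: "nbhd G v \<inter> (pverts G - D) = {u}"
    using assms unfolding super_dominating_def by blast
  show thesis
  proof (rule that[OF v])
    show "v \<in> pverts G"
      using v assms(1) unfolding super_dominating_def by blast
    show "\<forall>x \<in> pverts G - D. (v, x) \<in> parcs G \<longleftrightarrow> x = u"
      using N in_nbhd_iff[of _ G v] by blast
  qed
qed

lemma finite_super_dominating:
  assumes "finite (pverts G)"
  shows "finite {D. super_dominating G D}"
  by (rule finite_subset[of _ "Pow (pverts G)"]) (use assms in \<open>auto simp: super_dominating_def\<close>)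

lemma super_domination_number_le_card:
  assumes "finite (pverts G)" and "super_dominating G D"
  shows "\<gamma>\<^sub>s\<^sub>p G \<le> card D"
  using assms finite_super_dominating unfolding super_domination_number_def
  by (intro Min_le) auto

lemma super_domination_number_attained:
  assumes "finite (pverts G)"
  obtains D where "super_dominating G D" and "card D = \<gamma>\<^sub>s\<^sub>p G"
proof -
  have "super_dominating G (pverts G)"
    by (simp add: super_dominating_def)
  then have "Min (card ` {D. super_dominating G D}) \<in> card ` {D. super_dominating G D}"
    using finite_super_dominating[OF assms] by (intro Min_in) auto
  then show thesis
    using that by (auto simp: super_domination_number_def)
qed

text \<open>One endpoint of an edge can always be left out: the other endpoint dominates it.\<close>

lemma super_domination_number_less_order:
  assumes "pair_graph H" and "parcs H \<noteq> {}"
  shows "\<gamma>\<^sub>s\<^sub>p H < card (pverts H)"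
proof -
  interpret H: pair_graph H by fact
  obtain a b where ab: "(a, b) \<in> parcs H"
    using assms(2) by auto
  then have a: "a \<in> pverts H" and b: "b \<in> pverts H" and ne: "a \<noteq> b"
    using H.in_arcsD1 H.in_arcsD2 H.pair_no_loops by fastforce+
  have "super_dominating H (pverts H - {b})"
    unfolding super_dominating_def using ab a b ne by (auto intro!: bexI[of _ a])
  from super_domination_number_le_card[OF H.pair_finite_verts this]
  have "\<gamma>\<^sub>s\<^sub>p H \<le> card (pverts H - {b})" .
  also have "\<dots> < card (pverts H)"
    using b H.pair_finite_verts by (intro psubset_card_mono) auto
  finally show ?thesis .
qed

section \<open>Super dominating sets of lexicographic products\<close>

lemma pverts_lex_product [simp]: "pverts (K \<circ>\<^sub>L H) = pverts K \<times> pverts H"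
  by (simp add: lex_product_def)

lemma in_parcs_lex_product_iff [simp]:
  "((g, h), (g', h')) \<in> parcs (K \<circ>\<^sub>L H) \<longleftrightarrow>
     g \<in> pverts K \<and> h \<in> pverts H \<and> g' \<in> pverts K \<and> h' \<in> pverts H \<and>
     ((g, g') \<in> parcs K \<or> g = g' \<and> (h, h') \<in> parcs H)"
  by (simp add: lex_product_def)

text \<open>
  The omitted vertices all lie over \<open>I\<close>. Since \<open>I\<close> is independent, a vertex over \<open>I\<close> sees only
  the omitted vertices of its own copy of \<open>H\<close>, exactly as in \<open>H\<close>.
\<close>

lemma super_dominating_lex_independent:
  assumes S: "super_dominating H S" and I: "I \<subseteq> pverts K"
    and indep: "parcs K \<inter> I \<times> I = {}"
  shows "super_dominating (K \<circ>\<^sub>L H) ((pverts K - I) \<times> pverts H \<union> I \<times> S)"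
    (is "super_dominating _ ?D")
proof -
  have SV: "S \<subseteq> pverts H"
    using S by (simp add: super_dominating_def)
  have C: "pverts (K \<circ>\<^sub>L H) - ?D = I \<times> (pverts H - S)"
    using I by auto
  have "\<exists>v\<in>?D. nbhd (K \<circ>\<^sub>L H) v \<inter> I \<times> (pverts H - S) = {(g, h)}"
    if g: "g \<in> I" and h: "h \<in> pverts H - S" for g h
  proof -
    obtain v where v: "v \<in> S" "nbhd H v \<inter> (pverts H - S) = {h}"
      using S h unfolding super_dominating_def by blast
    have "nbhd (K \<circ>\<^sub>L H) (g, v) \<inter> I \<times> (pverts H - S)
        = {g} \<times> (nbhd H v \<inter> (pverts H - S))"
      using g v(1) SV I indep by auto
    then have "nbhd (K \<circ>\<^sub>L H) (g, v) \<inter> I \<times> (pverts H - S) = {(g, h)}"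
      using v(2) by simp
    moreover have "(g, v) \<in> ?D"
      using g v(1) by simp
    ultimately show ?thesis
      by (rule rev_bexI[rotated])
  qed
  then show ?thesis
    unfolding super_dominating_def C using I SV by auto
qed

text \<open>
  Either the fibre over \<open>g\<close> meets the complement in at most one vertex, or all dominating
  vertices for it lie in the same copy of \<open>H\<close>, so that the trace of the super dominating set on
  this copy is super dominating in \<open>H\<close>.
\<close>

lemma card_fibre_complement_le:
  assumes H: "pair_graph H" "parcs H \<noteq> {}"
    and D: "super_dominating (K \<circ>\<^sub>L H) D" and g: "g \<in> pverts K"
  shows "card {h \<in> pverts H. (g, h) \<notin> D} \<le> card (pverts H) - \<gamma>\<^sub>s\<^sub>p H"
    (is "card ?C \<le> _")
proof (cases "card ?C \<le> 1")
  case True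
  then show ?thesis
    using super_domination_number_less_order[OF H] by linarith
next
  case False
  interpret H: pair_graph H by fact
  note fin = H.pair_finite_verts
  have "\<exists>v\<in>pverts H - ?C. nbhd H v \<inter> ?C = {h}" if h: "h \<in> ?C" for h
  proof -
    have "(g, h) \<in> pverts (K \<circ>\<^sub>L H) - D"
      using h g by simp
    then obtain p where p: "p \<in> D" "p \<in> pverts (K \<circ>\<^sub>L H)"
      and Np: "\<forall>x \<in> pverts (K \<circ>\<^sub>L H) - D.
        (p, x) \<in> parcs (K \<circ>\<^sub>L H) \<longleftrightarrow> x = (g, h)"
      by (elim super_dominatingE[OF D]) blast
    obtain g' v where p_eq: "p = (g', v)"
      by (cases p)
    have v: "(g', v) \<in> D" and V: "g' \<in> pverts K" "v \<in> pverts H"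
      using p by (simp_all add: p_eq)
    have N: "(g', g) \<in> parcs K \<or> g' = g \<and> (v, x) \<in> parcs H \<longleftrightarrow> x = h" if "x \<in> ?C" for x
      using Np[rule_format, of "(g, x)"] that V g by (simp add: p_eq)
    \<comment> \<open>A dominating vertex from another copy would see a second vertex of the complement.\<close>
    have "\<not> ?C \<subseteq> {h}"
      using False card_mono[of "{h}" ?C] by auto
    then obtain h' where h': "h' \<in> ?C" "h' \<noteq> h"
      by blast
    then have other: "(g', g) \<notin> parcs K"
      using N by blast
    then have "g' = g"
      using N[OF h] by blast
    moreover from this have "nbhd H v \<inter> ?C = {h}"
      using N other h by auto
    ultimately show ?thesis
      using v V by (intro bexI[of _ v]) auto
  qed
  moreover have "pverts H - (pverts H - ?C) = ?C"
    by blast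
  ultimately have "super_dominating H (pverts H - ?C)"
    unfolding super_dominating_def by auto
  from super_domination_number_le_card[OF fin this]
  have "\<gamma>\<^sub>s\<^sub>p H \<le> card (pverts H) - card ?C"
    using fin by (subst (asm) card_Diff_subset) auto
  moreover have "card ?C \<le> card (pverts H)"
    using fin by (intro card_mono) auto
  ultimately show ?thesis
    by linarith
qed

lemma card_complement_le:
  assumes H: "pair_graph H" "parcs H \<noteq> {}" and K: "pair_graph K"
    and D: "super_dominating (K \<circ>\<^sub>L H) D" and P: "P \<subseteq> pverts K"
    and sub: "pverts (K \<circ>\<^sub>L H) - D \<subseteq> P \<times> pverts H"
  shows "card (pverts (K \<circ>\<^sub>L H) - D) \<le> card P * (card (pverts H) - \<gamma>\<^sub>s\<^sub>p H)"
proof -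
  interpret H: pair_graph H by fact
  interpret K: pair_graph K by fact
  have fin: "finite P"
    using P K.pair_finite_verts finite_subset by blast
  have "pverts (K \<circ>\<^sub>L H) - D = (SIGMA g:P. {h \<in> pverts H. (g, h) \<notin> D})"
    using sub P by auto
  then have "card (pverts (K \<circ>\<^sub>L H) - D) = (\<Sum>g\<in>P. card {h \<in> pverts H. (g, h) \<notin> D})"
    using fin H.pair_finite_verts by simp
  also have "\<dots> \<le> card P * (card (pverts H) - \<gamma>\<^sub>s\<^sub>p H)"
  proof -
    have "card {h \<in> pverts H. (g, h) \<notin> D} \<le> card (pverts H) - \<gamma>\<^sub>s\<^sub>p H" if "g \<in> P" for g
      using card_fibre_complement_le[OF H D, of g] that P by auto
    from sum_bounded_above[of P, OF this] show ?thesis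
      by simp
  qed
  finally show ?thesis .
qed

section \<open>Complete bipartite base graphs\<close>

text \<open>
  A dominating vertex over \<open>A\<close> would also see the vertex of the complement over \<open>B\<close>, so the
  vertex \<open>(a, h)\<close> is dominated from over \<open>B\<close>, where every vertex sees all of \<open>A \<times> pverts H\<close>.
\<close>

lemma complement_meets_both_parts:
  assumes K: "pverts K = A \<union> B" "A \<inter> B = {}" "parcs K = A \<times> B \<union> B \<times> A"
    and D: "super_dominating (K \<circ>\<^sub>L H) D"
    and a: "(a, h) \<in> pverts (K \<circ>\<^sub>L H) - D" "a \<in> A"
    and b: "(b, k) \<in> pverts (K \<circ>\<^sub>L H) - D" "b \<in> B"
  shows "(pverts (K \<circ>\<^sub>L H) - D) \<inter> A \<times> UNIV = {(a, h)}"
proof -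
  obtain p where p: "p \<in> pverts (K \<circ>\<^sub>L H)"
    and Np: "\<forall>x \<in> pverts (K \<circ>\<^sub>L H) - D.
      (p, x) \<in> parcs (K \<circ>\<^sub>L H) \<longleftrightarrow> x = (a, h)"
    using super_dominatingE[OF D a(1)] by blast
  obtain g v where p_eq: "p = (g, v)"
    by (cases p)
  note V = p[unfolded p_eq] and N = Np[unfolded p_eq, rule_format]
  have "g \<notin> A"
    using N[OF b(1)] K V a b by auto
  then have "g \<in> B"
    using V K(1) by auto
  then have "x = (a, h)" if "x \<in> pverts (K \<circ>\<^sub>L H) - D" "x \<in> A \<times> UNIV" for x
    using N[OF that(1)] that K(1,3) V by (cases x) auto
  then show ?thesis
    using a by auto
qed

theorem proposition17:
  fixes K :: "'a pair_pre_digraph" and H :: "'b pair_pre_digraph" and r t n' :: nat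
  assumes "pair_graph K" and "K\<^bsub>r,t\<^esub> (with_proj K)"
    and "pair_graph H" and "parcs H \<noteq> {}" and "card (pverts H) = n'"
    and "r \<ge> 1" and "t \<ge> 1" and "r \<le> t" and "t \<ge> 2"
  shows "\<gamma>\<^sub>s\<^sub>p (K \<circ>\<^sub>L H) = t * \<gamma>\<^sub>s\<^sub>p H + r * n'"
proof -
  interpret K: pair_graph K by fact
  interpret H: pair_graph H by fact
  obtain U W where UW: "pverts K = U \<union> W" "U \<inter> W = {}" "parcs K = U \<times> W \<union> W \<times> U"
    and card: "card U = r" "card W = t"
    using assms(2) unfolding complete_bipartite_digraph_pair_def by blast
  have WU: "pverts K = W \<union> U" "W \<inter> U = {}" "parcs K = W \<times> U \<union> U \<times> W"
    using UW by auto
  have finUW: "finite U" "finite W"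
    using K.pair_finite_verts UW(1) by auto
  note finH = H.pair_finite_verts
  have fin: "finite (pverts (K \<circ>\<^sub>L H))"
    using K.pair_finite_verts finH by simp
  have order: "card (pverts (K \<circ>\<^sub>L H)) = (r + t) * n'"
    using UW finUW card assms(5) by (simp add: card_cartesian_product card_Un_disjoint)
  have less: "\<gamma>\<^sub>s\<^sub>p H < n'"
    using super_domination_number_less_order[OF assms(3,4)] assms(5) by simp

  have upper: "\<gamma>\<^sub>s\<^sub>p (K \<circ>\<^sub>L H) \<le> t * \<gamma>\<^sub>s\<^sub>p H + r * n'"
  proof -
    obtain S where S: "super_dominating H S" "card S = \<gamma>\<^sub>s\<^sub>p H"
      using super_domination_number_attained[OF finH] .
    then have finS: "finite S"
      using finH finite_subset unfolding super_dominating_def by blast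
    have "super_dominating (K \<circ>\<^sub>L H) ((pverts K - W) \<times> pverts H \<union> W \<times> S)"
      using S(1) UW by (intro super_dominating_lex_independent) auto
    moreover have "pverts K - W = U"
      using UW by auto
    ultimately have "\<gamma>\<^sub>s\<^sub>p (K \<circ>\<^sub>L H) \<le> card (U \<times> pverts H \<union> W \<times> S)"
      using super_domination_number_le_card[OF fin] by simp
    also have "\<dots> \<le> card (U \<times> pverts H) + card (W \<times> S)"
      by (rule card_Un_le)
    also have "\<dots> = t * \<gamma>\<^sub>s\<^sub>p H + r * n'"
      using card S(2) assms(5) by (simp add: card_cartesian_product)
    finally show ?thesis .
  qed

  obtain D where D: "super_dominating (K \<circ>\<^sub>L H) D" "card D = \<gamma>\<^sub>s\<^sub>p (K \<circ>\<^sub>L H)"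
    using super_domination_number_attained[OF fin] .
  define C where "C = pverts (K \<circ>\<^sub>L H) - D"
  have CV: "C \<subseteq> (U \<union> W) \<times> pverts H"
    using UW(1) by (auto simp: C_def)
  have C_le: "card C \<le> t * (n' - \<gamma>\<^sub>s\<^sub>p H)"
  proof -
    consider "C \<inter> U \<times> UNIV = {}" | "C \<inter> W \<times> UNIV = {}"
      | "C \<inter> U \<times> UNIV \<noteq> {}" "C \<inter> W \<times> UNIV \<noteq> {}"
      by blast
    then show ?thesis
    proof cases
      case 1
      then have "C \<subseteq> W \<times> pverts H"
        using CV by auto
      then show ?thesis
        using card_complement_le[OF assms(3,4,1) D(1), of W] UW card assms(5)
        by (simp add: C_def)
    next
      case 2
      then have "C \<subseteq> U \<times> pverts H"
        using CV by auto
      then have "card C \<le> r * (n' - \<gamma>\<^sub>s\<^sub>p H)"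
        using card_complement_le[OF assms(3,4,1) D(1), of U] UW card assms(5)
        by (simp add: C_def)
      also have "\<dots> \<le> t * (n' - \<gamma>\<^sub>s\<^sub>p H)"
        using assms(8) by simp
      finally show ?thesis .
    next
      case 3
      then obtain a h b k where a: "(a, h) \<in> C" "a \<in> U" and b: "(b, k) \<in> C" "b \<in> W"
        by auto
      have "C \<inter> U \<times> UNIV = {(a, h)}"
        using complement_meets_both_parts[OF UW D(1), of a h b k] a b by (simp add: C_def)
      moreover have "C \<inter> W \<times> UNIV = {(b, k)}"
        using complement_meets_both_parts[OF WU D(1), of b k a h] a b by (simp add: C_def)
      moreover have "C = C \<inter> U \<times> UNIV \<union> C \<inter> W \<times> UNIV"
        using CV by auto
      ultimately have "C = {(a, h), (b, k)}"
        by auto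
      then have "card C \<le> 2"
        by (simp add: card_insert_if)
      also have "2 \<le> t * 1"
        using assms(9) by simp
      also have "\<dots> \<le> t * (n' - \<gamma>\<^sub>s\<^sub>p H)"
        using less by (intro mult_le_mono2) simp
      finally show ?thesis .
    qed
  qed
  have DV: "D \<subseteq> pverts (K \<circ>\<^sub>L H)"
    using D(1) by (simp add: super_dominating_def)
  then have "card C = card (pverts (K \<circ>\<^sub>L H)) - card D"
    unfolding C_def using fin finite_subset by (intro card_Diff_subset) blast+
  then have "card D + card C = (r + t) * n'"
    using card_mono[OF fin DV] order by linarith
  moreover have "t * (n' - \<gamma>\<^sub>s\<^sub>p H) + t * \<gamma>\<^sub>s\<^sub>p H = t * n'"
    using less by (simp flip: distrib_left)
  ultimately have "t * \<gamma>\<^sub>s\<^sub>p H + r * n' \<le> \<gamma>\<^sub>s\<^sub>p (K \<circ>\<^sub>L H)"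
    using C_le D(2) by (simp add: distrib_right)
  with upper show ?thesis
    by simp
qed

end
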